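(* Let $(X,d)$ be a complete regular semimetric space and let $\varphi\colon\mathbb{R}_+\to\mathbb{R}_+$ be a comparison function. Then every $\varphi$-contraction $T\colon X\to X$ has a unique fixed point.
   Context: $\mathbb{R}_+=[0,\infty)$ and $\overline{\mathbb{R}}_+=[0,\infty]$. A semimetric space is a pair $(X,d)$ where $X$ is a nonempty set and $d\colon X\times X\to\mathbb{R}_+$ is symmetric and satisfies $d(x,y)=0$ if and only if $x=y$ (no triangle inequality is assumed). A sequence $(x_n)$ converges to $x\in X$ if $d(x_n,x)\to 0$; it is Cauchy if for every $\varepsilon>0$ there is $N$ such that $d(x_n,x_m)<\varepsilon$ for all $n,m\ge N$. The space is complete if every Cauchy sequence converges to some point of $X$. The basic triangle function of $(X,d)$ is $\Phi_d\colon\overline{\mathbb{R}}_+^2\to\overline{\mathbb{R}}_+$, $\Phi_d(u,v):=\sup\{d(x,y)\mid x,y\in X,\ \exists p\in X:\ d(p,x)\le u,\ d(p,y)\le v\}$. The semimetric space $(X,d)$ is called regular if $\Phi_d$ is continuous at the origin $(0,0)$ (note $\Phi_d(0,0)=0$). A comparison function is a monotone increasing (i.e. nondecreasing) function $\varphi\colon\mathbb{R}_+\to\mathbb{R}_+$ such that $\lim_{n\to\infty}\varphi^n(t)=0$ for all $t\ge 0$, where $\varphi^n$ is the $n$-th iterate. Given a comparison function $\varphi$, a mapping $T\colon X\to X$ is a $\varphi$-contraction if $d(Tx,Ty)\le\varphi(d(x,y))$ for all $x,y\in X$. *)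

theory Defs
  imports "HOL-Analysis.Analysis"
begin

(* A space is a carrier set X with a distance d whose values off X are irrelevant. *)

definition semimetric_space :: "'a set \<Rightarrow> ('a \<Rightarrow> 'a \<Rightarrow> real) \<Rightarrow> bool" where
  "semimetric_space X d \<longleftrightarrow>
     X \<noteq> {} \<and>
     (\<forall>x\<in>X. \<forall>y\<in>X. 0 \<le> d x y) \<and>
     (\<forall>x\<in>X. \<forall>y\<in>X. d x y = d y x) \<and>
     (\<forall>x\<in>X. \<forall>y\<in>X. d x y = 0 \<longleftrightarrow> x = y)"

definition semimetric_converges :: "('a \<Rightarrow> 'a \<Rightarrow> real) \<Rightarrow> (nat \<Rightarrow> 'a) \<Rightarrow> 'a \<Rightarrow> bool" where
  "semimetric_converges d s x \<longleftrightarrow> (\<lambda>n. d (s n) x) \<longlonglongrightarrow> 0"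

definition semimetric_Cauchy :: "('a \<Rightarrow> 'a \<Rightarrow> real) \<Rightarrow> (nat \<Rightarrow> 'a) \<Rightarrow> bool" where
  "semimetric_Cauchy d s \<longleftrightarrow> (\<forall>\<epsilon>>0. \<exists>N. \<forall>n\<ge>N. \<forall>m\<ge>N. d (s n) (s m) < \<epsilon>)"

definition semimetric_complete :: "'a set \<Rightarrow> ('a \<Rightarrow> 'a \<Rightarrow> real) \<Rightarrow> bool" where
  "semimetric_complete X d \<longleftrightarrow>
     (\<forall>s. range s \<subseteq> X \<and> semimetric_Cauchy d s \<longrightarrow> (\<exists>x\<in>X. semimetric_converges d s x))"

(* The extended half-line [0,\<infinity>] is ennreal; its topology near 0 is the usual one. *)

definition basic_triangle_function ::
    "'a set \<Rightarrow> ('a \<Rightarrow> 'a \<Rightarrow> real) \<Rightarrow> ennreal \<Rightarrow> ennreal \<Rightarrow> ennreal" where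
  "basic_triangle_function X d u v =
     Sup {ennreal (d x y) | x y. x \<in> X \<and> y \<in> X \<and>
            (\<exists>p\<in>X. ennreal (d p x) \<le> u \<and> ennreal (d p y) \<le> v)}"

definition semimetric_regular :: "'a set \<Rightarrow> ('a \<Rightarrow> 'a \<Rightarrow> real) \<Rightarrow> bool" where
  "semimetric_regular X d \<longleftrightarrow> isCont (\<lambda>(u, v). basic_triangle_function X d u v) (0, 0)"

(* The half-line [0,\<infinity>) is {0..} :: real set; values of \<phi> at negative arguments are irrelevant. *)

definition comparison_function :: "(real \<Rightarrow> real) \<Rightarrow> bool" where
  "comparison_function \<phi> \<longleftrightarrow>
     \<phi> \<in> {0..} \<rightarrow> {0..} \<and> mono_on {0..} \<phi> \<and> (\<forall>t\<ge>0. (\<lambda>n. (\<phi> ^^ n) t) \<longlonglongrightarrow> 0)"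

definition phi_contraction ::
    "'a set \<Rightarrow> ('a \<Rightarrow> 'a \<Rightarrow> real) \<Rightarrow> (real \<Rightarrow> real) \<Rightarrow> ('a \<Rightarrow> 'a) \<Rightarrow> bool" where
  "phi_contraction X d \<phi> T \<longleftrightarrow>
     T \<in> X \<rightarrow> X \<and> (\<forall>x\<in>X. \<forall>y\<in>X. d (T x) (T y) \<le> \<phi> (d x y))"

end

theory Submission
  imports Defs
begin

text \<open>
  Without the triangle inequality the usual geometric-series estimate for the Picard
  sequence \<open>x\<^sub>n = T\<^sup>n x\<^sub>0\<close> is not available. Regularity supplies the following substitute: for each
  \<open>\<epsilon> > 0\<close> there is a \<open>\<delta> > 0\<close> such that two points that are \<open>\<delta>\<close>-close to a common third point are
  \<open>\<epsilon>\<close>-close to each other (\<open>regular_weak_triangle\<close>). This already makes limits unique.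

  The heart of the proof is the Cauchy property (\<open>picard_sequence_Cauchy\<close>). Since a single
  application of \<open>T\<close> may shrink a ball too little, one passes to an iterate \<open>T\<^sup>n\<close> for which
  \<open>\<phi>\<^sup>n \<epsilon> \<le> \<delta>\<close>. If \<open>x\<^sub>k\<close> is so far along the sequence that \<open>T\<^sup>n\<close> moves it by at most \<open>\<delta>\<close>, then
  \<open>T\<^sup>n\<close> maps the \<open>\<epsilon>\<close>-ball around \<open>x\<^sub>k\<close> into itself: for \<open>y\<close> in this ball both \<open>T\<^sup>n y\<close> and \<open>x\<^sub>k\<close>
  are \<open>\<delta>\<close>-close to \<open>T\<^sup>n x\<^sub>k\<close>. If moreover the first \<open>n\<close> terms from \<open>x\<^sub>k\<close> on lie in the ball, then
  this invariance keeps every later term there.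

  By completeness the Picard sequence has a limit. As \<open>\<phi> t < t\<close> for \<open>t > 0\<close>, the map \<open>T\<close> is
  continuous along it, so the limit is a fixed point, and two distinct fixed points would be
  at a distance \<open>t > 0\<close> with \<open>t \<le> \<phi> t\<close>.
\<close>

section \<open>Comparison functions\<close>

lemma comparison_funpow_nonneg:
  assumes "comparison_function \<phi>" "0 \<le> t"
  shows "0 \<le> (\<phi> ^^ n) t"
  using assms by (induction n) (auto simp: comparison_function_def)

lemma comparison_funpow_mono:
  assumes "comparison_function \<phi>" "0 \<le> s" "s \<le> t"
  shows "(\<phi> ^^ n) s \<le> (\<phi> ^^ n) t"
proof (induction n)
  case (Suc n)
  have "0 \<le> (\<phi> ^^ n) s" "0 \<le> (\<phi> ^^ n) t"
    using assms comparison_funpow_nonneg[of \<phi>] by auto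
  then show ?case
    using Suc assms(1) mono_onD[of "{0..}" \<phi>] by (auto simp: comparison_function_def)
qed (use assms in simp)

text \<open>If \<open>t \<le> \<phi> t\<close>, monotonicity would keep all iterates above \<open>t\<close>, so they could not tend to \<open>0\<close>.\<close>

lemma comparison_less:
  assumes "comparison_function \<phi>" "0 < t"
  shows "\<phi> t < t"
proof (rule ccontr)
  assume "\<not> \<phi> t < t"
  have above: "t \<le> (\<phi> ^^ n) t" for n
  proof (induction n)
    case (Suc n)
    have "t \<le> \<phi> t" using \<open>\<not> \<phi> t < t\<close> by simp
    also have "\<dots> \<le> \<phi> ((\<phi> ^^ n) t)"
      using comparison_funpow_mono[OF assms(1) _ Suc, of 1] assms(2) by simp
    finally show ?case by simp
  qed simp
  have "(\<lambda>n. (\<phi> ^^ n) t) \<longlonglongrightarrow> 0"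
    using assms by (simp add: comparison_function_def)
  then have "t \<le> 0"
    by (rule LIMSEQ_le_const) (use above in blast)
  with assms(2) show False by simp
qed

lemma comparison_le:
  assumes "comparison_function \<phi>" "0 \<le> t"
  shows "\<phi> t \<le> t"
proof (cases "t = 0")
  case True
  have "\<phi> 0 \<le> 0 + s" if "0 < s" for s
    using comparison_funpow_mono[OF assms(1), of 0 s 1] comparison_less[OF assms(1) that] that
    by simp
  with True show ?thesis using field_le_epsilon by blast
qed (use comparison_less[OF assms(1), of t] assms(2) in simp)

section \<open>Regularity as a weak triangle inequality\<close>

lemma semimetric_dist_nonneg:
  assumes "semimetric_space X d" "x \<in> X" "y \<in> X"
  shows "0 \<le> d x y"
  using assms by (simp add: semimetric_space_def)

lemma semimetric_eq_if_dist_le_0: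
  assumes "semimetric_space X d" "x \<in> X" "y \<in> X" "d x y \<le> 0"
  shows "x = y"
proof -
  have "d x y = 0" using assms by (simp add: semimetric_space_def order_antisym)
  then show ?thesis using assms(1-3) unfolding semimetric_space_def by blast
qed

text \<open>
  The basic triangle function \<open>\<Phi>\<close> vanishes at the origin, so along the diagonal \<open>u = v = 1 / (n + 1)\<close>
  continuity gives \<open>\<Phi> u v < \<epsilon>\<close> for some \<open>n\<close>; this \<open>u\<close> is the required \<open>\<delta>\<close>.
\<close>

lemma regular_weak_triangle:
  assumes "semimetric_space X d" "semimetric_regular X d" "0 < \<epsilon>"
  obtains \<delta> where "0 < \<delta>"
    "\<And>p x y. \<lbrakk>p \<in> X; x \<in> X; y \<in> X; d p x \<le> \<delta>; d p y \<le> \<delta>\<rbrakk> \<Longrightarrow> d x y < \<epsilon>"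
proof -
  let ?\<Phi> = "basic_triangle_function X d"
  let ?r = "\<lambda>n. ennreal (inverse (real (Suc n)))"
  have at_origin: "ennreal (d x y) \<le> 0"
    if "x \<in> X" "y \<in> X" "p \<in> X" "ennreal (d p x) \<le> 0" "ennreal (d p y) \<le> 0" for x y p
  proof -
    have "d p x \<le> 0" "d p y \<le> 0" using that(4,5) by (simp_all add: ennreal_eq_0_iff)
    then have "p = x" "p = y"
      using semimetric_eq_if_dist_le_0[OF assms(1) that(3)] that(1,2) by blast+
    then show ?thesis using \<open>d p x \<le> 0\<close> by (simp add: ennreal_eq_0_iff)
  qed
  have "?\<Phi> 0 0 \<le> 0"
    unfolding basic_triangle_function_def by (intro Sup_least) (clarify, rule at_origin)
  then have zero: "?\<Phi> 0 0 = 0" by simp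
  have r: "?r \<longlonglongrightarrow> 0"
    using tendsto_ennrealI[OF LIMSEQ_inverse_real_of_nat] by simp
  have "(\<lambda>n. case (?r n, ?r n) of (u, v) \<Rightarrow> ?\<Phi> u v) \<longlonglongrightarrow> (case (0, 0) of (u, v) \<Rightarrow> ?\<Phi> u v)"
    using assms(2) unfolding semimetric_regular_def
    by (rule isCont_tendsto_compose) (intro tendsto_Pair r)
  then have "(\<lambda>n. ?\<Phi> (?r n) (?r n)) \<longlonglongrightarrow> 0" by (simp add: zero)
  then have "\<forall>\<^sub>F n in sequentially. ?\<Phi> (?r n) (?r n) < ennreal \<epsilon>"
    by (rule order_tendstoD) (use assms(3) in simp)
  then obtain n where n: "?\<Phi> (?r n) (?r n) < ennreal \<epsilon>"
    using eventually_happens'[OF sequentially_bot] by blast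
  show ?thesis
  proof (rule that[of "inverse (real (Suc n))"])
    fix p x y
    assume *: "p \<in> X" "x \<in> X" "y \<in> X"
      "d p x \<le> inverse (real (Suc n))" "d p y \<le> inverse (real (Suc n))"
    then have "ennreal (d x y) \<le> ?\<Phi> (?r n) (?r n)"
      unfolding basic_triangle_function_def by (intro Sup_upper) (blast intro: ennreal_leI)
    then have "ennreal (d x y) < ennreal \<epsilon>" using n by simp
    then show "d x y < \<epsilon>"
      using assms(1) * by (simp add: semimetric_space_def ennreal_less_iff)
  qed simp
qed

lemma semimetric_limit_unique:
  assumes "semimetric_space X d" "semimetric_regular X d"
    and "range s \<subseteq> X" "x \<in> X" "y \<in> X"
    and "semimetric_converges d s x" "semimetric_converges d s y"
  shows "x = y"
proof -
  have "d x y \<le> 0 + \<epsilon>" if pos: "0 < \<epsilon>" for \<epsilon>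
  proof -
    obtain \<delta> where "0 < \<delta>" and
      \<delta>: "\<And>p x y. \<lbrakk>p \<in> X; x \<in> X; y \<in> X; d p x \<le> \<delta>; d p y \<le> \<delta>\<rbrakk> \<Longrightarrow> d x y < \<epsilon>"
      using regular_weak_triangle[OF assms(1,2) pos] by metis
    have "\<forall>\<^sub>F n in sequentially. d (s n) x < \<delta>" "\<forall>\<^sub>F n in sequentially. d (s n) y < \<delta>"
      using assms(6,7) \<open>0 < \<delta>\<close> unfolding semimetric_converges_def by (auto dest: order_tendstoD)
    then have "\<forall>\<^sub>F n in sequentially. d (s n) x < \<delta> \<and> d (s n) y < \<delta>"
      by (rule eventually_conj)
    then obtain n where "d (s n) x < \<delta>" "d (s n) y < \<delta>"
      using eventually_happens'[OF sequentially_bot] by blast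
    then show ?thesis using \<delta>[of "s n" x y] assms(3-5) by force
  qed
  then have "d x y \<le> 0" using field_le_epsilon by blast
  then show ?thesis by (rule semimetric_eq_if_dist_le_0[OF assms(1,4,5)])
qed

section \<open>Iterates of contractions\<close>

lemma contraction_funpow_in:
  assumes "phi_contraction X d \<phi> T" "x \<in> X"
  shows "(T ^^ n) x \<in> X"
  using assms by (induction n) (auto simp: phi_contraction_def)

lemma contraction_funpow_dist_le:
  assumes "semimetric_space X d" "comparison_function \<phi>" "phi_contraction X d \<phi> T"
    and "x \<in> X" "y \<in> X"
  shows "d ((T ^^ n) x) ((T ^^ n) y) \<le> (\<phi> ^^ n) (d x y)"
proof (induction n)
  case (Suc n)
  have X: "(T ^^ n) x \<in> X" "(T ^^ n) y \<in> X"
    using contraction_funpow_in assms(3-5) by metis+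
  then have "d ((T ^^ Suc n) x) ((T ^^ Suc n) y) \<le> \<phi> (d ((T ^^ n) x) ((T ^^ n) y))"
    using assms(3) by (simp add: phi_contraction_def)
  also have "\<dots> \<le> \<phi> ((\<phi> ^^ n) (d x y))"
    using comparison_funpow_mono[OF assms(2) _ Suc, of 1] assms(1) X
    by (simp add: semimetric_space_def)
  finally show ?case by simp
qed simp

lemma contraction_orbits_merge:
  assumes "semimetric_space X d" "comparison_function \<phi>" "phi_contraction X d \<phi> T"
    and "x \<in> X" "y \<in> X"
  shows "(\<lambda>k. d ((T ^^ k) x) ((T ^^ k) y)) \<longlonglongrightarrow> 0"
proof (rule tendsto_sandwich)
  show "\<forall>\<^sub>F k in sequentially. 0 \<le> d ((T ^^ k) x) ((T ^^ k) y)"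
    using assms contraction_funpow_in[OF assms(3)] by (simp add: semimetric_space_def)
  show "\<forall>\<^sub>F k in sequentially. d ((T ^^ k) x) ((T ^^ k) y) \<le> (\<phi> ^^ k) (d x y)"
    using contraction_funpow_dist_le[OF assms] by simp
  show "(\<lambda>k. (\<phi> ^^ k) (d x y)) \<longlonglongrightarrow> 0"
    using assms by (simp add: comparison_function_def semimetric_space_def)
qed simp

text \<open>
  Every \<open>\<epsilon>\<close>-ball around a sufficiently late term captures the rest of the sequence; a second
  use of the weak triangle inequality, centred at that term, then compares two arbitrary later terms.
\<close>

lemma picard_sequence_Cauchy:
  assumes "semimetric_space X d" "semimetric_regular X d"
    and "comparison_function \<phi>" "phi_contraction X d \<phi> T" "x \<in> X"
  shows "semimetric_Cauchy d (\<lambda>n. (T ^^ n) x)"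
  unfolding semimetric_Cauchy_def
proof (intro allI impI)
  fix \<epsilon>' :: real assume "0 < \<epsilon>'"
  let ?x = "\<lambda>n. (T ^^ n) x"
  note in_X = contraction_funpow_in[OF assms(4)]
  obtain \<epsilon> where "0 < \<epsilon>" and
    \<epsilon>: "\<And>p x y. \<lbrakk>p \<in> X; x \<in> X; y \<in> X; d p x \<le> \<epsilon>; d p y \<le> \<epsilon>\<rbrakk> \<Longrightarrow> d x y < \<epsilon>'"
    using regular_weak_triangle[OF assms(1,2) \<open>0 < \<epsilon>'\<close>] by metis
  obtain \<delta> where "0 < \<delta>" and
    \<delta>: "\<And>p x y. \<lbrakk>p \<in> X; x \<in> X; y \<in> X; d p x \<le> \<delta>; d p y \<le> \<delta>\<rbrakk> \<Longrightarrow> d x y < \<epsilon>"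
    using regular_weak_triangle[OF assms(1,2) \<open>0 < \<epsilon>\<close>] by metis
  have "(\<lambda>n. (\<phi> ^^ n) \<epsilon>) \<longlonglongrightarrow> 0"
    using assms(3) \<open>0 < \<epsilon>\<close> by (simp add: comparison_function_def)
  then have "\<forall>\<^sub>F n in sequentially. (\<phi> ^^ n) \<epsilon> < \<delta> \<and> 0 < n"
    using \<open>0 < \<delta>\<close> by (intro eventually_conj order_tendstoD eventually_gt_at_top)
  then obtain n where n: "(\<phi> ^^ n) \<epsilon> < \<delta>" "0 < n"
    using eventually_happens'[OF sequentially_bot] by blast
  \<comment> \<open>The bound \<open>\<epsilon>\<close> puts a full block of \<open>n\<close> terms into the ball, the base of the induction below;
    the bound \<open>\<delta>\<close>, taken at \<open>i = n\<close>, controls the displacement of \<open>x\<^sub>k\<close> under \<open>T\<^sup>n\<close>.\<close>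
  have "\<forall>\<^sub>F k in sequentially. \<forall>i\<in>{..n}. d (?x k) (?x (k + i)) < min \<epsilon> \<delta>"
  proof (intro eventually_ball_finite ballI)
    fix i
    show "\<forall>\<^sub>F k in sequentially. d (?x k) (?x (k + i)) < min \<epsilon> \<delta>"
      using order_tendstoD(2)[of _ 0 _ "min \<epsilon> \<delta>",
          OF contraction_orbits_merge[OF assms(1,3,4,5) in_X[OF assms(5), of i]]]
        \<open>0 < \<epsilon>\<close> \<open>0 < \<delta>\<close> by (simp add: funpow_add)
  qed simp
  then obtain k where k: "\<And>i. i \<le> n \<Longrightarrow> d (?x k) (?x (k + i)) < min \<epsilon> \<delta>"
    using eventually_happens'[OF sequentially_bot] by fastforce
  have ball_invariant: "d (?x k) ((T ^^ n) y) \<le> \<epsilon>" if "y \<in> X" "d (?x k) y \<le> \<epsilon>" for y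
  proof -
    let ?p = "(T ^^ n) (?x k)"
    have X: "?p \<in> X" "?x k \<in> X" "(T ^^ n) y \<in> X"
      using in_X that(1) assms(5) by metis+
    have "?p = ?x (k + n)"
      by (metis add.commute comp_apply funpow_add)
    then have "d ?p (?x k) \<le> \<delta>"
      using k[of n] assms(1) X by (simp add: semimetric_space_def)
    moreover have "d ?p ((T ^^ n) y) \<le> \<delta>"
    proof -
      have "d ?p ((T ^^ n) y) \<le> (\<phi> ^^ n) (d (?x k) y)"
        using contraction_funpow_dist_le[OF assms(1,3,4) X(2) that(1)] .
      also have "\<dots> \<le> (\<phi> ^^ n) \<epsilon>"
        using comparison_funpow_mono[OF assms(3) _ that(2)] assms(1) X(2) that(1)
        by (simp add: semimetric_space_def)
      finally show ?thesis using n(1) by simp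
    qed
    ultimately show ?thesis using \<delta>[OF X] by simp
  qed
  have tail: "d (?x k) (?x (k + m)) \<le> \<epsilon>" for m
  proof (induction m rule: less_induct)
    case (less m)
    show ?case
    proof (cases "m \<le> n")
      case True
      then show ?thesis using k[of m] by simp
    next
      case False
      then have "d (?x k) (?x (k + (m - n))) \<le> \<epsilon>"
        using less.IH[of "m - n"] n(2) by simp
      then have "d (?x k) ((T ^^ n) (?x (k + (m - n)))) \<le> \<epsilon>"
        by (rule ball_invariant[OF in_X[OF assms(5)]])
      moreover have "(T ^^ n) (?x (k + (m - n))) = (T ^^ (n + (k + (m - n)))) x"
        by (simp add: funpow_add)
      moreover have "n + (k + (m - n)) = k + m" using False by simp
      ultimately show ?thesis by simp
    qed
  qed
  show "\<exists>N. \<forall>n\<ge>N. \<forall>m\<ge>N. d (?x n) (?x m) < \<epsilon>'"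
  proof (intro exI[of _ k] allI impI)
    fix n m assume "k \<le> n" "k \<le> m"
    then show "d (?x n) (?x m) < \<epsilon>'"
      using \<epsilon>[OF in_X[OF assms(5), of k] in_X[OF assms(5), of n] in_X[OF assms(5), of m]]
        tail[of "n - k"] tail[of "m - k"] by simp
  qed
qed

section \<open>The fixed point theorem\<close>

theorem theorem1:
  fixes X :: "'a set" and d :: "'a \<Rightarrow> 'a \<Rightarrow> real"
    and \<phi> :: "real \<Rightarrow> real" and T :: "'a \<Rightarrow> 'a"
  assumes "semimetric_space X d"
    and "semimetric_complete X d"
    and "semimetric_regular X d"
    and "comparison_function \<phi>"
    and "phi_contraction X d \<phi> T"
  shows "\<exists>!x. x \<in> X \<and> T x = x"
proof -
  have "X \<noteq> {}" using assms(1) unfolding semimetric_space_def by (rule conjunct1)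
  then obtain x0 where "x0 \<in> X" by blast
  let ?x = "\<lambda>n. (T ^^ n) x0"
  have in_X: "?x n \<in> X" for n using contraction_funpow_in[OF assms(5) \<open>x0 \<in> X\<close>] .
  have "semimetric_Cauchy d ?x"
    using picard_sequence_Cauchy[OF assms(1,3,4,5) \<open>x0 \<in> X\<close>] .
  then obtain x where "x \<in> X" and lim: "semimetric_converges d ?x x"
    using assms(2) in_X unfolding semimetric_complete_def by (metis image_subsetI)
  have "T x \<in> X" using assms(5) \<open>x \<in> X\<close> by (auto simp: phi_contraction_def)
  have lim_shift: "semimetric_converges d (\<lambda>n. ?x (Suc n)) x"
    using lim unfolding semimetric_converges_def by (rule LIMSEQ_Suc)
  have "semimetric_converges d (\<lambda>n. ?x (Suc n)) (T x)"
    unfolding semimetric_converges_def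
  proof (rule tendsto_sandwich)
    have "0 \<le> d (?x (Suc n)) (T x)" for n
      using semimetric_dist_nonneg[OF assms(1) in_X \<open>T x \<in> X\<close>] .
    then show "\<forall>\<^sub>F n in sequentially. 0 \<le> d (?x (Suc n)) (T x)" by simp
    have "d (?x (Suc n)) (T x) \<le> d (?x n) x" for n
    proof -
      have "d (?x (Suc n)) (T x) \<le> \<phi> (d (?x n) x)"
        using assms(5) in_X \<open>x \<in> X\<close> by (simp add: phi_contraction_def)
      also have "\<dots> \<le> d (?x n) x"
        using comparison_le[OF assms(4)] assms(1) in_X \<open>x \<in> X\<close> by (simp add: semimetric_space_def)
      finally show ?thesis .
    qed
    then show "\<forall>\<^sub>F n in sequentially. d (?x (Suc n)) (T x) \<le> d (?x n) x" by simp
    show "(\<lambda>n. d (?x n) x) \<longlonglongrightarrow> 0" using lim unfolding semimetric_converges_def .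
  qed simp
  then have "T x = x"
    using semimetric_limit_unique[OF assms(1,3) _ \<open>T x \<in> X\<close> \<open>x \<in> X\<close> _ lim_shift] in_X by blast
  moreover have "y = x" if "y \<in> X" "T y = y" for y
  proof (rule ccontr)
    assume "y \<noteq> x"
    then have "0 < d y x"
      using semimetric_eq_if_dist_le_0[OF assms(1) that(1) \<open>x \<in> X\<close>] by force
    moreover have "d y x \<le> \<phi> (d y x)"
      using assms(5) that \<open>x \<in> X\<close> \<open>T x = x\<close> unfolding phi_contraction_def by metis
    ultimately show False using comparison_less[OF assms(4)] by fastforce
  qed
  ultimately show ?thesis using \<open>x \<in> X\<close> by blast
qed

end
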